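(* Let $0\neq A_0\in\mathfrak{gl}_n(\mathbb{R})$, let $\mu_{A(t)}$ be the bracket flow starting at $\mu_{A_0}$ and set $B(t)=\frac{A(t)}{\|A(t)\|}$. Then $F(B)=\|[B,B^t]\|^2$ is a non-negative, non-increasing function along the flow, i.e. $t\mapsto F(B(t))$ is non-negative and non-increasing. Moreover, $\frac{d}{dt}\big|_{t=t_0}F(B(t))=0$ for some $t_0$ if and only if $\mu_{B(0)}$ is an algebraic soliton.
   Context: Let $n\ge1$ and equip $\mathbb{R}^{n+1}=\mathbb{R}e_0\oplus\mathbb{R}^n$ with the canonical inner product $\langle\cdot,\cdot\rangle$ and canonical basis $e_0,e_1,\dots,e_n$. For $A\in\mathfrak{gl}_n(\mathbb{R})$, $\mu_A$ is the Lie bracket on $\mathbb{R}^{n+1}$ given by $\mu_A(e_0,e_i)=Ae_i$ and $\mu_A(e_i,e_j)=0$ for $i,j\ge1$, where $A$ acts on $\mathbb{R}^n=\langle e_1,\dots,e_n\rangle$. $G_{\mu_A}$ is the simply connected Lie group with Lie algebra $(\mathbb{R}^{n+1},\mu_A)$ and $g_{\mu_A}$ is the left-invariant Riemannian metric on it equal to $\langle\cdot,\cdot\rangle$ at the identity. $\mu_A$ is called an algebraic soliton if the Ricci operator of $(G_{\mu_A},g_{\mu_A})$ has the form $cI+D$ with $c\in\mathbb{R}$ and $D$ a derivation of $(\mathbb{R}^{n+1},\mu_A)$. The bracket flow starting at $\mu_{A_0}$ is $\mu_{A(t)}$, where $A(t)$ is the solution (on its maximal interval, which contains $[0,\infty)$)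 of $$\tfrac{d}{dt}A=-\operatorname{tr}(S(A)^2)A+\tfrac12[A,[A,A^t]]-\tfrac12\operatorname{tr}(A)[A,A^t],\quad A(0)=A_0,\qquad S(A)=\tfrac12(A+A^t).$$ Here $\|A\|^2=\operatorname{tr}(AA^t)$. *)

theory Defs
  imports "HOL-Analysis.Analysis"
begin

definition commutator :: "real^'n^'n \<Rightarrow> real^'n^'n \<Rightarrow> real^'n^'n" where
  "commutator A B = A ** B - B ** A"

definition sym_part :: "real^'n^'n \<Rightarrow> real^'n^'n" where
  "sym_part A = (1/2) *\<^sub>R (A + transpose A)"

text \<open>The library norm on matrices is the Frobenius norm.\<close>

lemma norm_matrix_eq_trace:
  fixes A :: "real^'n^'n"
  shows "(norm A)\<^sup>2 = trace (A ** transpose A)"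
  by (simp add: power2_norm_eq_inner inner_vec_def trace_def matrix_matrix_mult_def transpose_def)

definition F :: "real^'n^'n \<Rightarrow> real" where
  "F B = (norm (commutator B (transpose B)))\<^sup>2"


text \<open>
  The space \<open>\<real>e\<^sub>0 \<oplus> \<real>\<^sup>n\<close> is rendered as the product type
  \<open>real \<times> (real^'n)\<close> with its product inner product; \<open>e\<^sub>0 = (1, 0)\<close>. The bracket \<open>\<mu>_A\<close> is
  the skew-symmetric bilinear extension of \<open>\<mu>_A(e\<^sub>0, x) = A x\<close> and \<open>\<mu>_A(x, y) = 0\<close>
  for \<open>x, y \<in> \<real>\<^sup>n\<close>.
\<close>

definition mu :: "real^'n^'n \<Rightarrow> real \<times> (real^'n) \<Rightarrow> real \<times> (real^'n) \<Rightarrow> real \<times> (real^'n)" where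
  "mu A X Y = (0, fst X *\<^sub>R (A *v snd Y) - fst Y *\<^sub>R (A *v snd X))"

definition lie_bracket :: "('a::euclidean_space \<Rightarrow> 'a \<Rightarrow> 'a) \<Rightarrow> bool" where
  "lie_bracket \<mu> \<longleftrightarrow> bilinear \<mu> \<and> (\<forall>X. \<mu> X X = 0) \<and>
     (\<forall>X Y Z. \<mu> X (\<mu> Y Z) + \<mu> Y (\<mu> Z X) + \<mu> Z (\<mu> X Y) = 0)"

lemma lie_bracket_mu: "lie_bracket (mu A)"
  unfolding lie_bracket_def bilinear_def
  by (auto intro!: linearI simp: mu_def matrix_vector_right_distrib matrix_vector_mult_scaleR
        matrix_vector_mult_diff_distrib scaleR_left.add zero_prod_def algebra_simps)

lemma mu_e0: "mu A (1, 0) (0, x) = (0, A *v x)"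
  by (simp add: mu_def)

lemma mu_ideal: "mu A (0, x) (0, y) = 0"
  by (simp add: mu_def zero_prod_def)


text \<open>
  Curvature of the left-invariant metric with value \<open>\<langle>\<cdot>,\<cdot>\<rangle>\<close> at the identity, on the simply
  connected Lie group with Lie algebra \<open>\<mu>\<close>. Elements of the Lie algebra are identified with
  left-invariant vector fields, on which inner products are constant functions and the Lie
  bracket is \<open>\<mu>\<close>. As the Levi-Civita connection and all curvature tensors are left-invariant,
  they are determined by their values on these fields.

  For left-invariant \<open>X, Y, Z\<close> the derivative \<open>X\<langle>Y, Z\<rangle>\<close> vanishes, so compatibility with the
  metric reads \<open>\<langle>\<nabla>\<^sub>X Y, Z\<rangle> + \<langle>Y, \<nabla>\<^sub>X Z\<rangle> = 0\<close>.
\<close>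

definition is_levi_civita :: "('a::euclidean_space \<Rightarrow> 'a \<Rightarrow> 'a) \<Rightarrow> ('a \<Rightarrow> 'a \<Rightarrow> 'a) \<Rightarrow> bool" where
  "is_levi_civita \<mu> N \<longleftrightarrow> bilinear N \<and>
     (\<forall>X Y. N X Y - N Y X = \<mu> X Y) \<and>
     (\<forall>X Y Z. N X Y \<bullet> Z + Y \<bullet> N X Z = 0)"

definition levi_civita :: "('a::euclidean_space \<Rightarrow> 'a \<Rightarrow> 'a) \<Rightarrow> 'a \<Rightarrow> 'a \<Rightarrow> 'a" where
  "levi_civita \<mu> = (THE N. is_levi_civita \<mu> N)"

lemma koszul:
  assumes "is_levi_civita \<mu> N"
  shows "2 * (N X Y \<bullet> Z) = \<mu> X Y \<bullet> Z - \<mu> Y Z \<bullet> X + \<mu> Z X \<bullet> Y"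
proof -
  have t: "\<mu> P Q = N P Q - N Q P" for P Q
    using assms by (simp add: is_levi_civita_def)
  have m: "N P Q \<bullet> R = - (N P R \<bullet> Q)" for P Q R
    using assms unfolding is_levi_civita_def
    by (metis add_eq_0_iff inner_commute minus_minus)
  show ?thesis
    unfolding t inner_diff_left
    using m[of X Y Z] m[of Y X Z] m[of Z X Y] by simp
qed

lemma ex1_levi_civita:
  fixes \<mu> :: "'a::euclidean_space \<Rightarrow> 'a \<Rightarrow> 'a"
  assumes "lie_bracket \<mu>"
  shows "\<exists>!N. is_levi_civita \<mu> N"
proof (rule ex_ex1I)
  have bil: "bilinear \<mu>" and alt: "\<And>X. \<mu> X X = 0"
    using assms by (auto simp: lie_bracket_def)
  note ls = bilinear_ladd[OF bil] bilinear_radd[OF bil] bilinear_lmul[OF bil] bilinear_rmul[OF bil]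
  have skew: "\<mu> Y X = - \<mu> X Y" for X Y
  proof -
    have "\<mu> X Y + \<mu> Y X = 0"
      using alt[of "X + Y"] unfolding ls by (simp add: alt add.commute)
    then show ?thesis
      by (simp add: eq_neg_iff_add_eq_0 add.commute)
  qed
  define k where "k X Y Z = (\<mu> X Y \<bullet> Z - \<mu> Y Z \<bullet> X + \<mu> Z X \<bullet> Y) / 2" for X Y Z
  define N where "N X Y = (\<Sum>b\<in>Basis. k X Y b *\<^sub>R b)" for X Y
  have lk: "linear (k X Y)" for X Y
    by (auto intro!: linearI simp: k_def ls inner_simps algebra_simps add_divide_distrib diff_divide_distrib)
  have N: "N X Y \<bullet> Z = k X Y Z" for X Y Z
  proof -
    have "k X Y Z = k X Y (\<Sum>b\<in>Basis. (Z \<bullet> b) *\<^sub>R b)"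
      by (simp add: euclidean_representation)
    also have "\<dots> = (\<Sum>b\<in>Basis. (Z \<bullet> b) * k X Y b)"
      by (simp add: linear_sum[OF lk] linear_scale[OF lk])
    finally show ?thesis
      by (simp add: N_def inner_sum_left inner_commute[of Z] mult.commute)
  qed
  have "is_levi_civita \<mu> N"
    unfolding is_levi_civita_def bilinear_def
  proof (intro conjI allI linearI)
    fix X Y Z :: 'a and c :: real
    show "N X (Y + Z) = N X Y + N X Z" "N (Y + Z) X = N Y X + N Z X"
         "N X (c *\<^sub>R Y) = c *\<^sub>R N X Y" "N (c *\<^sub>R Y) X = c *\<^sub>R N Y X"
      by (rule euclidean_eqI, simp add: inner_add_left N, simp add: k_def ls inner_simps field_simps)+
    show "N X Y - N Y X = \<mu> X Y"
    proof (rule euclidean_eqI)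
      fix b :: 'a
      show "(N X Y - N Y X) \<bullet> b = \<mu> X Y \<bullet> b"
        using skew[of X Y] skew[of Y b] skew[of X b]
        by (simp add: inner_diff_left N k_def field_simps)
    qed
    show "N X Y \<bullet> Z + Y \<bullet> N X Z = 0"
      using skew[of X Y] skew[of Y Z] skew[of X Z]
      by (simp add: N inner_commute[of Y] k_def field_simps)
  qed
  then show "\<exists>N. is_levi_civita \<mu> N" by blast
next
  fix N N'
  assume *: "is_levi_civita \<mu> N" "is_levi_civita \<mu> N'"
  have "N X Y = N' X Y" for X Y
  proof (rule euclidean_eqI)
    fix b :: 'a
    show "N X Y \<bullet> b = N' X Y \<bullet> b"
      using koszul[OF *(1), of X Y b] koszul[OF *(2), of X Y b] by simp
  qed
  then show "N = N'" by blast
qed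

definition riemann :: "('a::euclidean_space \<Rightarrow> 'a \<Rightarrow> 'a) \<Rightarrow> 'a \<Rightarrow> 'a \<Rightarrow> 'a \<Rightarrow> 'a" where
  "riemann \<mu> X Y Z = levi_civita \<mu> X (levi_civita \<mu> Y Z) - levi_civita \<mu> Y (levi_civita \<mu> X Z)
     - levi_civita \<mu> (\<mu> X Y) Z"

text \<open>\<open>ric(X, Y)\<close> is the trace of \<open>Z \<mapsto> R(Z, X)Y\<close>, and the Ricci operator is the
  endomorphism with \<open>\<langle>Ric X, Y\<rangle> = ric(X, Y)\<close>.\<close>

definition ricci :: "('a::euclidean_space \<Rightarrow> 'a \<Rightarrow> 'a) \<Rightarrow> 'a \<Rightarrow> 'a \<Rightarrow> real" where
  "ricci \<mu> X Y = (\<Sum>b\<in>Basis. riemann \<mu> b X Y \<bullet> b)"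

definition ricci_operator :: "('a::euclidean_space \<Rightarrow> 'a \<Rightarrow> 'a) \<Rightarrow> 'a \<Rightarrow> 'a" where
  "ricci_operator \<mu> X = (\<Sum>b\<in>Basis. ricci \<mu> X b *\<^sub>R b)"

definition derivation :: "('a::euclidean_space \<Rightarrow> 'a \<Rightarrow> 'a) \<Rightarrow> ('a \<Rightarrow> 'a) \<Rightarrow> bool" where
  "derivation \<mu> D \<longleftrightarrow> linear D \<and> (\<forall>X Y. D (\<mu> X Y) = \<mu> (D X) Y + \<mu> X (D Y))"

definition algebraic_soliton :: "('a::euclidean_space \<Rightarrow> 'a \<Rightarrow> 'a) \<Rightarrow> bool" where
  "algebraic_soliton \<mu> \<longleftrightarrow>
     (\<exists>c D. derivation \<mu> D \<and> (\<forall>X. ricci_operator \<mu> X = c *\<^sub>R X + D X))"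


definition bracket_flow_rhs :: "real^'n^'n \<Rightarrow> real^'n^'n" where
  "bracket_flow_rhs A =
     - trace (sym_part A ** sym_part A) *\<^sub>R A
     + (1/2) *\<^sub>R commutator A (commutator A (transpose A))
     - ((1/2) * trace A) *\<^sub>R commutator A (transpose A)"

definition flow_solution :: "real^'n^'n \<Rightarrow> real set \<Rightarrow> (real \<Rightarrow> real^'n^'n) \<Rightarrow> bool" where
  "flow_solution A\<^sub>0 J A \<longleftrightarrow> open J \<and> is_interval J \<and> 0 \<in> J \<and> A 0 = A\<^sub>0 \<and>
     (\<forall>t\<in>J. (A has_vector_derivative bracket_flow_rhs (A t)) (at t))"

text \<open>\<open>J\<close> is the maximal interval of existence: the solution has no proper extension.\<close>

definition bracket_flow :: "real^'n^'n \<Rightarrow> real set \<Rightarrow> (real \<Rightarrow> real^'n^'n) \<Rightarrow> bool" where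
  "bracket_flow A\<^sub>0 J A \<longleftrightarrow> flow_solution A\<^sub>0 J A \<and>
     (\<forall>J' A'. flow_solution A\<^sub>0 J' A' \<and> J \<subseteq> J' \<and> (\<forall>t\<in>J. A' t = A t) \<longrightarrow> J' = J)"

end

theory Submission
  imports Defs
begin

text \<open>
  Write \<open>M = [X, X\<^sup>t]\<close>. Apart from a multiple of \<open>A\<close>, which normalization removes, the right-hand
  side of the bracket flow is the cubic field \<open>drift X = (1/2) [X, M] - (1/2) (tr X) M\<close>. Hence
  \<open>B = A / \<parallel>A\<parallel>\<close> solves \<open>B' = \<parallel>A\<parallel>\<^sup>2 \<Phi>(B)\<close>, where \<open>\<Phi>\<close> (\<open>sphere_drift\<close>) is the tangential part of the
  drift on the unit sphere. The differential of \<open>F\<close> at \<open>X\<close> is \<open>H \<mapsto> -4 \<langle>H, [X, M]\<rangle>\<close>, so \<open>[X, M]\<close> is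
  up to a factor the negative gradient of \<open>F\<close>. The trace identities \<open>\<langle>X, M\<rangle> = 0\<close>,
  \<open>\<langle>[X, M], M\<rangle> = 0\<close> and \<open>\<langle>X, [X, M]\<rangle> = - F X\<close> give
    \<open>d/dt F(B) = - 2 \<parallel>A\<parallel>\<^sup>2 (\<parallel>[B, M]\<parallel>\<^sup>2 - F(B)\<^sup>2)\<close>.
  As \<open>\<parallel>B\<parallel> = 1\<close>, this is nonpositive by Cauchy--Schwarz applied to \<open>B\<close> and \<open>[B, M]\<close>, and it
  vanishes exactly when \<open>[B, M]\<close> is a multiple of \<open>B\<close>. Since the trace term of the drift vanishes
  both in that case and whenever the drift is radial, this amounts to \<open>\<Phi>(B) = 0\<close>
  (\<open>norm_commutator_moment_eq_iff\<close>).

  The geometric side leads to the same condition. The Ricci operator of \<open>\<mu>_A\<close> is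
  \<open>- tr(S\<^sup>2)\<close> on \<open>e\<^sub>0\<close> and \<open>E = (1/2) [A, A\<^sup>t] - (tr A) S\<close> on \<open>\<real>\<^sup>n\<close> (\<open>ricci_operator_mu\<close>). A block diagonal
  map with blocks \<open>d\<close> and \<open>E - c\<close> is a derivation iff \<open>[E, A] = d A\<close>, and \<open>[E, A] = - drift A\<close>. So
  \<open>\<mu>_A\<close> is an algebraic soliton iff \<open>drift A\<close> is a multiple of \<open>A\<close>
  (\<open>algebraic_soliton_mu_iff\<close>).

  It remains to pass from the time \<open>t\<^sub>0\<close> to the time \<open>0\<close>. The field \<open>\<Phi>\<close> is polynomial, hence
  Lipschitz on bounded sets, so a solution that meets a zero of \<open>\<Phi>\<close> is constant
  (\<open>ode_stays_at_equilibrium\<close>): if \<open>\<Phi>(B(t\<^sub>0)) = 0\<close> then \<open>B(0) = B(t\<^sub>0)\<close>. The same argument at the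
  equilibrium \<open>0\<close> of the unnormalized flow shows that \<open>A\<close> never vanishes.
\<close>

section \<open>Commutators and the trace inner product\<close>

lemma matrix_diff_ldistrib: "A ** (B - C) = A ** B - A ** C" for A :: "real^'n^'m"
  by (simp add: matrix_matrix_mult_def vec_eq_iff right_diff_distrib sum_subtractf)

lemma matrix_diff_rdistrib: "(B - C) ** A = B ** A - C ** A" for A :: "real^'n^'m"
  by (simp add: matrix_matrix_mult_def vec_eq_iff left_diff_distrib sum_subtractf)

lemma matrix_sum_rdistrib: "(B + C) ** A = B ** A + C ** A" for A :: "real^'n^'m"
  by (simp add: matrix_matrix_mult_def vec_eq_iff distrib_right sum.distrib)

lemma transpose_plus: "transpose (A + B) = transpose A + transpose B" for A :: "real^'n^'m"
  by (simp add: transpose_def vec_eq_iff)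

lemma transpose_diff: "transpose (A - B) = transpose A - transpose B" for A :: "real^'n^'m"
  by (simp add: transpose_def vec_eq_iff)

lemma trace_scaleR: "trace (c *\<^sub>R A) = c * trace A" for A :: "real^'n^'n"
  by (simp add: trace_def sum_distrib_left)

lemma inner_matrix_eq_trace: "A \<bullet> B = trace (A ** transpose B)" for A B :: "real^'n^'n"
  by (simp add: inner_vec_def trace_def matrix_matrix_mult_def transpose_def)

lemma inner_transpose: "transpose A \<bullet> transpose B = A \<bullet> B" for A B :: "real^'n^'n"
  by (metis inner_commute inner_matrix_eq_trace trace_mul_sym transpose_transpose)

lemma bounded_linear_transpose: "bounded_linear (transpose :: real^'n^'n \<Rightarrow> _)"
  by (rule linear_conv_bounded_linear[THEN iffD1], rule linearI)
    (simp_all add: transpose_plus transpose_scalar)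

lemma bounded_linear_trace: "bounded_linear (trace :: real^'n^'n \<Rightarrow> real)"
  by (rule linear_conv_bounded_linear[THEN iffD1], rule linearI)
    (simp_all add: trace_add trace_scaleR)

lemma bounded_bilinear_commutator: "bounded_bilinear commutator"
  unfolding bilinear_conv_bounded_bilinear[symmetric] bilinear_def commutator_def
  by (auto intro!: linearI simp: matrix_add_ldistrib matrix_sum_rdistrib
      scalar_matrix_assoc matrix_scalar_ac algebra_simps)

lemma commutator_self [simp]: "commutator X X = 0"
  by (simp add: commutator_def)

lemma commutator_swap: "commutator Y X = - commutator X Y"
  by (simp add: commutator_def)

lemma commutator_scaleR:
  "commutator (c *\<^sub>R X) Y = c *\<^sub>R commutator X Y" "commutator X (c *\<^sub>R Y) = c *\<^sub>R commutator X Y"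
  by (simp_all add: bounded_bilinear.scaleR_left[OF bounded_bilinear_commutator]
      bounded_bilinear.scaleR_right[OF bounded_bilinear_commutator])

lemma transpose_commutator: "transpose (commutator X Y) = commutator (transpose Y) (transpose X)"
  by (simp add: commutator_def transpose_diff matrix_transpose_mul)

lemma trace_commutator [simp]: "trace (commutator X Y) = 0"
  by (simp add: commutator_def trace_sub trace_mul_sym[of X Y])

text \<open>
  With respect to the trace form, the adjoint of \<open>X \<mapsto> [X, Y]\<close> is \<open>Z \<mapsto> [Z, Y\<^sup>t]\<close>. All later
  identities between inner products of iterated commutators are instances of this one.
\<close>

lemma inner_commutator_adjoint:
  "commutator X Y \<bullet> Z = X \<bullet> commutator Z (transpose Y)"
proof -
  have "trace (Y ** X ** transpose Z) = trace (X ** (transpose Z ** Y))"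
    by (metis trace_mul_sym matrix_mul_assoc)
  then show ?thesis
    by (simp add: inner_matrix_eq_trace commutator_def matrix_diff_rdistrib matrix_diff_ldistrib
        trace_sub transpose_diff matrix_transpose_mul matrix_mul_assoc)
qed

section \<open>The moment map and the flow modulo scaling\<close>

text \<open>
  Up to a factor, the moment map for the conjugation action of \<open>GL\<^sub>n\<close> on matrices. It vanishes exactly
  on the normal matrices.
\<close>

definition moment :: "real^'n^'n \<Rightarrow> real^'n^'n" where
  "moment X = commutator X (transpose X)"

definition drift :: "real^'n^'n \<Rightarrow> real^'n^'n" where
  "drift X = (1/2) *\<^sub>R commutator X (moment X) - ((1/2) * trace X) *\<^sub>R moment X"

text \<open>
  For \<open>\<parallel>X\<parallel> = 1\<close> this is the orthogonal projection of the drift to the tangent space of the unit sphere.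
\<close>

definition sphere_drift :: "real^'n^'n \<Rightarrow> real^'n^'n" where
  "sphere_drift X = drift X - (X \<bullet> drift X) *\<^sub>R X"

lemma bracket_flow_rhs_eq:
  "bracket_flow_rhs A = - trace (sym_part A ** sym_part A) *\<^sub>R A + drift A"
  by (simp add: bracket_flow_rhs_def drift_def moment_def)

lemma F_eq: "F X = moment X \<bullet> moment X"
  by (simp add: F_def moment_def power2_norm_eq_inner)

lemma transpose_moment [simp]: "transpose (moment X) = moment X"
  by (simp add: moment_def transpose_commutator)

lemma drift_scaleR: "drift (c *\<^sub>R X) = c ^ 3 *\<^sub>R drift X"
  by (simp add: drift_def moment_def transpose_scalar commutator_scaleR trace_scaleR
      scaleR_diff_right power3_eq_cube mult_ac)

lemma inner_self_moment: "X \<bullet> moment X = 0"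
proof -
  have "moment X \<bullet> X = X \<bullet> commutator X X"
    by (metis inner_commutator_adjoint moment_def transpose_transpose)
  then show ?thesis
    by (simp add: inner_commute)
qed

lemma inner_moment_commutator: "commutator X (moment X) \<bullet> moment X = 0"
  by (simp add: inner_commutator_adjoint)

lemma inner_self_commutator_moment: "X \<bullet> commutator X (moment X) = - F X"
proof -
  have "commutator (moment X) X \<bullet> X = moment X \<bullet> moment X"
    by (simp add: inner_commutator_adjoint moment_def)
  then show ?thesis
    by (simp add: commutator_swap[of X] F_eq inner_commute)
qed

lemma inner_self_drift: "X \<bullet> drift X = - F X / 2"
  by (simp add: drift_def inner_diff_right inner_self_moment inner_self_commutator_moment)

text \<open>
  Taking the trace of \<open>[X, M] = k X\<close> shows \<open>tr X = 0\<close> unless \<open>k = 0\<close>, and in the latter case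
  \<open>\<parallel>M\<parallel>\<^sup>2 = - \<langle>X, [X, M]\<rangle> = 0\<close>. Either way the trace term of the drift drops out.
\<close>

lemma eigen_commutator_moment:
  assumes "commutator X (moment X) = k *\<^sub>R X"
  shows "trace X *\<^sub>R moment X = 0"
proof (cases "k = 0")
  case True
  then have "F X = 0"
    using inner_self_commutator_moment[of X] assms by simp
  then show ?thesis
    by (simp add: F_eq)
next
  case False
  have "k * trace X = 0"
    using assms trace_commutator[of X "moment X"] by (simp add: trace_scaleR)
  with False show ?thesis by simp
qed

text \<open>
  Conversely, pairing \<open>drift X = k X\<close> with \<open>M\<close>, which is orthogonal to \<open>X\<close> and to \<open>[X, M]\<close>, leaves only
  \<open>(tr X) \<parallel>M\<parallel>\<^sup>2 = 0\<close>.
\<close>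

lemma commutator_moment_if_drift_radial:
  assumes "drift X = k *\<^sub>R X"
  shows "commutator X (moment X) = (2 * k) *\<^sub>R X"
proof -
  have "drift X \<bullet> moment X = 0"
    by (simp add: assms inner_self_moment)
  then have "trace X = 0 \<or> moment X = 0"
    by (simp add: drift_def inner_diff_left inner_moment_commutator)
  then have "drift X = (1/2) *\<^sub>R commutator X (moment X)"
    by (auto simp: drift_def)
  then have "commutator X (moment X) = 2 *\<^sub>R drift X"
    by simp
  then show ?thesis
    by (simp add: assms)
qed

lemma sphere_drift_eq_0_iff:
  assumes "norm X = 1"
  shows "sphere_drift X = 0 \<longleftrightarrow> (\<exists>k. drift X = k *\<^sub>R X)"
proof
  assume "\<exists>k. drift X = k *\<^sub>R X"
  then obtain k where k: "drift X = k *\<^sub>R X" ..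
  then show "sphere_drift X = 0"
    using assms by (simp add: sphere_drift_def norm_eq_1)
qed (auto simp: sphere_drift_def)

lemma F_nonneg: "0 \<le> F X"
  by (simp add: F_def)

text \<open>
  Cauchy--Schwarz for \<open>X\<close> and \<open>[X, M]\<close>, as \<open>\<langle>X, [X, M]\<rangle> = - F X\<close>.
\<close>

lemma F_le_norm_commutator_moment:
  assumes "norm X = 1"
  shows "F X ^ 2 \<le> (norm (commutator X (moment X)))\<^sup>2"
proof -
  have "\<bar>F X\<bar> \<le> norm (commutator X (moment X))"
    using Cauchy_Schwarz_ineq2[of X "commutator X (moment X)"] assms
    by (simp add: inner_self_commutator_moment)
  then show ?thesis
    by (metis abs_norm_cancel abs_le_square_iff)
qed

text \<open>
  The equality case of Cauchy--Schwarz, \<open>[X, M] = - F X \<cdot> X\<close>, is rephrased in terms of the drift: the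
  trace term of the drift vanishes on both sides of the equivalence.
\<close>

lemma norm_commutator_moment_eq_iff:
  assumes "norm X = 1"
  shows "(norm (commutator X (moment X)))\<^sup>2 = F X ^ 2 \<longleftrightarrow> sphere_drift X = 0"
proof -
  let ?C = "commutator X (moment X)"
  \<comment> \<open>The excess in Cauchy--Schwarz is the squared norm of the part of \<open>[X, M]\<close> orthogonal to \<open>X\<close>.\<close>
  have "(norm (?C + F X *\<^sub>R X))\<^sup>2 = (norm ?C)\<^sup>2 - F X ^ 2"
    using assms inner_self_commutator_moment[of X]
    unfolding power2_norm_eq_inner norm_eq_1
    by (simp add: inner_simps inner_commute[of ?C X] power2_eq_square)
  then have "(norm ?C)\<^sup>2 = F X ^ 2 \<longleftrightarrow> ?C = - F X *\<^sub>R X"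
    by (simp add: eq_neg_iff_add_eq_0) (metis add_cancel_right_left diff_add_cancel norm_eq_zero zero_eq_power2)
  also have "\<dots> \<longleftrightarrow> (\<exists>k. drift X = k *\<^sub>R X)"
  proof
    assume C: "?C = - F X *\<^sub>R X"
    have "drift X = (- F X / 2) *\<^sub>R X"
      using eigen_commutator_moment[OF C] by (auto simp: drift_def C)
    then show "\<exists>k. drift X = k *\<^sub>R X" ..
  next
    assume "\<exists>k. drift X = k *\<^sub>R X"
    then obtain k where C: "?C = (2 * k) *\<^sub>R X"
      using commutator_moment_if_drift_radial by blast
    have "2 * k = - F X"
      using inner_self_commutator_moment[of X] assms by (simp add: C norm_eq_1)
    with C show "?C = - F X *\<^sub>R X" by simp
  qed
  also have "\<dots> \<longleftrightarrow> sphere_drift X = 0"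
    by (simp add: sphere_drift_eq_0_iff assms)
  finally show ?thesis .
qed

lemma inner_sphere_drift_commutator_moment:
  assumes "norm X = 1"
  shows "sphere_drift X \<bullet> commutator X (moment X) =
    ((norm (commutator X (moment X)))\<^sup>2 - F X ^ 2) / 2"
proof -
  let ?C = "commutator X (moment X)"
  have "moment X \<bullet> ?C = 0"
    using inner_moment_commutator[of X] by (simp add: inner_commute)
  then have "drift X \<bullet> ?C = ?C \<bullet> ?C / 2"
    by (simp add: drift_def inner_diff_left)
  then show ?thesis
    unfolding sphere_drift_def inner_diff_left inner_scaleR_left inner_self_drift
      inner_self_commutator_moment power2_norm_eq_inner
    by (simp add: power2_eq_square field_simps)
qed

section \<open>The derivative of F along the flow\<close>

text \<open>
  The two terms of the differential of \<open>[X, X\<^sup>t]\<close> are transposes of each other, so they have the same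
  inner product with the symmetric matrix \<open>M\<close>; the adjoint rule for commutators then moves \<open>M\<close> away
  from the direction \<open>H\<close>.
\<close>

lemma has_derivative_F:
  "(F has_derivative (\<lambda>H. - 4 * (H \<bullet> commutator X (moment X)))) (at X)"
proof -
  let ?M' = "\<lambda>H. commutator X (transpose H) + commutator H (transpose X)"
  have M: "(moment has_derivative ?M') (at X)"
    unfolding moment_def
    by (rule bounded_bilinear.FDERIV[OF bounded_bilinear_commutator has_derivative_ident
          bounded_linear.has_derivative[OF bounded_linear_transpose has_derivative_ident]])
  have "(F has_derivative (\<lambda>H. moment X \<bullet> ?M' H + ?M' H \<bullet> moment X)) (at X)"
    unfolding F_eq[abs_def] by (rule bounded_bilinear.FDERIV[OF bounded_bilinear_inner M M])
  moreover have "?M' H \<bullet> moment X = - 2 * (H \<bullet> commutator X (moment X))" for H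
  proof -
    have "commutator X (transpose H) = transpose (commutator H (transpose X))"
      by (simp add: transpose_commutator)
    then have "commutator X (transpose H) \<bullet> moment X = commutator H (transpose X) \<bullet> moment X"
      by (metis inner_transpose transpose_moment)
    moreover have "commutator H (transpose X) \<bullet> moment X = - (H \<bullet> commutator X (moment X))"
      by (simp add: inner_commutator_adjoint commutator_swap[of X])
    ultimately show ?thesis
      by (simp add: inner_add_left)
  qed
  ultimately show ?thesis
    by (simp add: inner_commute[of "moment X"])
qed

text \<open>
  The multiple of \<open>A\<close> in the right-hand side is radial and is cancelled by normalization; the drift is
  homogeneous of degree three, which produces the factor \<open>\<parallel>A\<parallel>\<^sup>2\<close>.
\<close>

lemma normalized_flow_derivative:
  assumes A: "(A has_vector_derivative bracket_flow_rhs (A t)) (at t)" and nz: "A t \<noteq> 0"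
  shows "((\<lambda>t. (1 / norm (A t)) *\<^sub>R A t) has_vector_derivative
    (norm (A t))\<^sup>2 *\<^sub>R sphere_drift ((1 / norm (A t)) *\<^sub>R A t)) (at t)"
proof -
  define r where "r = norm (A t)"
  define s where "s = trace (sym_part (A t) ** sym_part (A t))"
  define D where "D = bracket_flow_rhs (A t)"
  have r: "r > 0" using nz by (simp add: r_def)
  have rr: "A t \<bullet> A t = r ^ 2" by (simp add: r_def power2_norm_eq_inner)
  have D: "D = - s *\<^sub>R A t + drift (A t)" by (simp add: D_def s_def bracket_flow_rhs_eq)
  have dA: "(A has_derivative (\<lambda>h. h *\<^sub>R D)) (at t)"
    using A by (simp add: has_vector_derivative_def D_def)
  have n: "((\<lambda>t. norm (A t)) has_derivative (\<lambda>h. h *\<^sub>R D \<bullet> sgn (A t))) (at t)"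
    using has_derivative_compose[OF dA has_derivative_norm[OF nz]] by simp
  have "((\<lambda>t. norm (A t)) has_real_derivative (A t \<bullet> D) / r) (at t)"
    unfolding has_field_derivative_def
    by (rule has_derivative_eq_rhs[OF n])
      (auto simp: sgn_div_norm r_def inner_commute field_simps)
  then have "((\<lambda>t. 1 / norm (A t)) has_real_derivative - (A t \<bullet> D) / r ^ 3) (at t)"
    using r unfolding r_def
    by (auto intro!: derivative_eq_intros simp: power2_eq_square power3_eq_cube)
  then have "((\<lambda>t. (1 / norm (A t)) *\<^sub>R A t) has_vector_derivative
      (1 / r) *\<^sub>R D + (- (A t \<bullet> D) / r ^ 3) *\<^sub>R A t) (at t)"
    unfolding r_def D_def by (intro has_vector_derivative_scaleR A)
  moreover have "(1 / r) *\<^sub>R D + (- (A t \<bullet> D) / r ^ 3) *\<^sub>R A t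
      = r ^ 2 *\<^sub>R sphere_drift ((1 / r) *\<^sub>R A t)"
  proof -
    have "(A t \<bullet> D) / r ^ 3 = (A t \<bullet> drift (A t)) / r ^ 3 - s / r"
      using r by (simp add: D inner_diff_right rr field_simps power2_eq_square power3_eq_cube)
    then show ?thesis
      using r unfolding sphere_drift_def drift_scaleR D
      by (simp add: scaleR_diff_right scaleR_diff_left scaleR_add_right power_divide
          power2_eq_square power3_eq_cube)
  qed
  ultimately show ?thesis by (simp add: r_def)
qed

section \<open>Equilibria\<close>

lemma lipschitz_on_bounded_image:
  assumes L: "L-lipschitz_on U f" and U: "bounded U"
  shows "bounded (f ` U)"
proof -
  obtain e where e: "\<And>x y. x \<in> U \<Longrightarrow> y \<in> U \<Longrightarrow> dist x y \<le> e"
    using U by (auto simp: bounded_two_points)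
  have "dist (f x) (f y) \<le> L * e" if "x \<in> U" "y \<in> U" for x y
    using lipschitz_onD[OF L that] mult_left_mono[OF e[OF that] lipschitz_on_nonneg[OF L]]
    by linarith
  then show ?thesis
    by (auto simp: bounded_two_points)
qed

text \<open>
  The vector fields considered here are built from linear and bilinear operations. The following closure
  properties therefore yield their Lipschitz continuity on bounded sets without computing a derivative.
\<close>

lemma bounded_bilinear_lipschitz_on:
  assumes h: "bounded_bilinear h" and U: "bounded U"
    and f: "\<exists>L. L-lipschitz_on U f" and g: "\<exists>L. L-lipschitz_on U g"
  shows "\<exists>L. L-lipschitz_on U (\<lambda>x. h (f x) (g x))"
proof -
  interpret bounded_bilinear h by (rule h)
  obtain K where K: "0 \<le> K" "\<And>a b. norm (h a b) \<le> norm a * norm b * K"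
    using nonneg_bounded by blast
  obtain L1 L2 where L: "L1-lipschitz_on U f" "L2-lipschitz_on U g"
    using f g by blast
  have "bounded (f ` U)" "bounded (g ` U)"
    using L U lipschitz_on_bounded_image by blast+
  then obtain P Q where P: "\<And>x. x \<in> U \<Longrightarrow> norm (f x) \<le> P" and Q: "\<And>x. x \<in> U \<Longrightarrow> norm (g x) \<le> Q"
    by (auto simp: bounded_iff)
  have "(max 0 P * L2 * K + L1 * max 0 Q * K)-lipschitz_on U (\<lambda>x. h (f x) (g x))"
  proof (rule lipschitz_onI)
    show "0 \<le> max 0 P * L2 * K + L1 * max 0 Q * K"
      using K L[THEN lipschitz_on_nonneg] by simp
    fix x y assume xy: "x \<in> U" "y \<in> U"
    have "h (f x) (g x) - h (f y) (g y) = h (f x) (g x - g y) + h (f x - f y) (g y)"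
      by (simp add: diff_left diff_right)
    then have "dist (h (f x) (g x)) (h (f y) (g y)) \<le>
        norm (f x) * norm (g x - g y) * K + norm (f x - f y) * norm (g y) * K"
      unfolding dist_norm by (metis norm_triangle_mono K(2))
    also have "\<dots> \<le> max 0 P * (L2 * dist x y) * K + (L1 * dist x y) * max 0 Q * K"
      using xy K(1) P[OF xy(1)] Q[OF xy(2)] L[THEN lipschitz_on_nonneg]
        lipschitz_onD[OF L(1) xy] lipschitz_onD[OF L(2) xy]
      by (intro add_mono mult_mono mult_nonneg_nonneg) (auto simp: dist_norm)
    finally show "dist (h (f x) (g x)) (h (f y) (g y)) \<le> (max 0 P * L2 * K + L1 * max 0 Q * K) * dist x y"
      by (simp add: algebra_simps)
  qed
  then show ?thesis ..
qed

lemma bounded_linear_lipschitz_on: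
  assumes "bounded_linear f" and "\<exists>L. L-lipschitz_on U g"
  shows "\<exists>L. L-lipschitz_on U (\<lambda>x. f (g x))"
proof -
  obtain B where "B-lipschitz_on (g ` U) f"
    using bounded_linear.lipschitz_boundE[OF assms(1)] by blast
  then show ?thesis
    using assms(2) lipschitz_on_compose2 by blast
qed

lemma lipschitz_on_diff_ex:
  fixes f g :: "'a::metric_space \<Rightarrow> 'b::real_normed_vector"
  assumes "\<exists>L. L-lipschitz_on U f" "\<exists>L. L-lipschitz_on U g"
  shows "\<exists>L. L-lipschitz_on U (\<lambda>x. f x - g x)" 
  using assms lipschitz_on_diff by blast

lemma drift_lipschitz_on:
  fixes U :: "(real^'n^'n) set"
  assumes U: "bounded U"
  shows "\<exists>L. L-lipschitz_on U drift"
proof -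
  have i: "\<exists>L. L-lipschitz_on U (\<lambda>X. X :: real^'n^'n)" using lipschitz_on_id by blast
  have M: "\<exists>L. L-lipschitz_on U moment"
    unfolding moment_def[abs_def]
    by (rule bounded_bilinear_lipschitz_on[OF bounded_bilinear_commutator U i
          bounded_linear_lipschitz_on[OF bounded_linear_transpose i]])
  show ?thesis
    unfolding drift_def[abs_def]
    by (intro lipschitz_on_diff_ex bounded_linear_lipschitz_on[OF bounded_linear_scaleR_right]
        bounded_bilinear_lipschitz_on[OF bounded_bilinear_commutator U i M]
        bounded_bilinear_lipschitz_on[OF bounded_bilinear_scaleR U]
        bounded_linear_lipschitz_on[OF bounded_linear_mult_right]
        bounded_linear_lipschitz_on[OF bounded_linear_trace i] M)
qed

lemma sphere_drift_lipschitz_on: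
  fixes U :: "(real^'n^'n) set"
  assumes U: "bounded U"
  shows "\<exists>L. L-lipschitz_on U sphere_drift"
proof -
  have i: "\<exists>L. L-lipschitz_on U (\<lambda>X. X :: real^'n^'n)" using lipschitz_on_id by blast
  show ?thesis
    unfolding sphere_drift_def[abs_def]
    by (intro lipschitz_on_diff_ex drift_lipschitz_on[OF U] i
        bounded_bilinear_lipschitz_on[OF bounded_bilinear_scaleR U]
        bounded_bilinear_lipschitz_on[OF bounded_bilinear_inner U])
qed

lemma bracket_flow_rhs_lipschitz_on:
  fixes U :: "(real^'n^'n) set"
  assumes U: "bounded U"
  shows "\<exists>L. L-lipschitz_on U bracket_flow_rhs"
proof -
  have i: "\<exists>L. L-lipschitz_on U (\<lambda>X. X :: real^'n^'n)" using lipschitz_on_id by blast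
  have "trace (sym_part X ** sym_part X) = sym_part X \<bullet> sym_part X" for X :: "real^'n^'n"
    by (simp add: inner_matrix_eq_trace sym_part_def transpose_scalar transpose_plus add.commute)
  then have eq: "bracket_flow_rhs = (\<lambda>X::real^'n^'n. drift X - (sym_part X \<bullet> sym_part X) *\<^sub>R X)"
    by (simp add: bracket_flow_rhs_eq fun_eq_iff)
  have "bounded_linear (sym_part :: real^'n^'n \<Rightarrow> _)"
    unfolding sym_part_def[abs_def]
    by (intro bounded_linear_add bounded_linear_const_scaleR bounded_linear_ident
        bounded_linear_transpose)
  then have S: "\<exists>L. L-lipschitz_on U (sym_part :: real^'n^'n \<Rightarrow> _)"
    using i bounded_linear_lipschitz_on by blast
  show ?thesis
    unfolding eq
    by (intro lipschitz_on_diff_ex drift_lipschitz_on[OF U] i S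
        bounded_bilinear_lipschitz_on[OF bounded_bilinear_scaleR U]
        bounded_bilinear_lipschitz_on[OF bounded_bilinear_inner U])
qed

text \<open>
  Uniqueness of solutions through a zero of the vector field. On the segment between the two times, the
  squared distance \<open>w\<close> to the equilibrium satisfies \<open>\<bar>w'\<bar> \<le> k w\<close> for some constant \<open>k\<close>, so
  \<open>w(u) exp(- k u)\<close> is nonincreasing and \<open>w(u) exp(k u)\<close> is nondecreasing; the former settles the times
  after \<open>t\<^sub>0\<close> and the latter the times before. The factor \<open>c\<close> allows for the change of time
  scale \<open>\<parallel>A\<parallel>\<^sup>2\<close> in the equation of the normalized flow.
\<close>

lemma ode_stays_at_equilibrium:
  fixes f :: "real \<Rightarrow> 'a::euclidean_space"
  assumes J: "is_interval J" and t: "t\<^sub>0 \<in> J" "t \<in> J"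
    and f: "\<And>t. t \<in> J \<Longrightarrow> (f has_vector_derivative c t *\<^sub>R \<Phi> (f t)) (at t)"
    and c: "continuous_on J c"
    and lip: "\<And>U. bounded U \<Longrightarrow> \<exists>L. L-lipschitz_on U \<Phi>"
    and eq: "\<Phi> p = 0" "f t\<^sub>0 = p"
  shows "f t = p"
proof -
  define I where "I = closed_segment t\<^sub>0 t"
  have I: "I \<subseteq> J" 
    unfolding I_def using J t by (simp add: closed_segment_subset is_interval_convex_1)
  have I': "compact I" "t\<^sub>0 \<in> I" "t \<in> I" by (auto simp: I_def)
  have "continuous_on J f"
    by (rule continuous_at_imp_continuous_on) (use f has_vector_derivative_continuous in blast)
  \<comment> \<open>The point \<open>p\<close> is added to the orbit because the Lipschitz estimate compares \<open>\<Phi> (f u)\<close> with \<open>\<Phi> p = 0\<close>.\<close>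
  then have bf: "bounded (insert p (f ` I))" and bc: "bounded (c ` I)"
    using compact_continuous_image[OF continuous_on_subset[OF _ I] I'(1)] c
    by (auto intro: compact_imp_bounded)
  obtain C where C: "\<And>u. u \<in> I \<Longrightarrow> \<bar>c u\<bar> \<le> C"
    using bc by (auto simp: bounded_iff)
  obtain L where L: "L-lipschitz_on (insert p (f ` I)) \<Phi>"
    using lip[OF bf] by blast
  define k where "k = 2 * (C * L)"
  define w where "w = (\<lambda>u. (f u - p) \<bullet> (f u - p))"
  define w' where "w' = (\<lambda>u. 2 * ((f u - p) \<bullet> c u *\<^sub>R \<Phi> (f u)))"
  have w: "(w has_real_derivative w' u) (at u)" if "u \<in> I" for u
  proof -
    have "((\<lambda>u. f u - p) has_vector_derivative c u *\<^sub>R \<Phi> (f u)) (at u)"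
      using f[of u] I that by (auto intro!: derivative_eq_intros)
    then have d: "((\<lambda>u. f u - p) has_derivative (\<lambda>h. h *\<^sub>R (c u *\<^sub>R \<Phi> (f u)))) (at u)"
      by (simp add: has_vector_derivative_def)
    show ?thesis
      unfolding has_field_derivative_def w_def
      by (rule has_derivative_eq_rhs[OF bounded_bilinear.FDERIV[OF bounded_bilinear_inner d d]])
        (simp add: fun_eq_iff w'_def inner_commute)
  qed
  have w': "\<bar>w' u\<bar> \<le> k * w u" if "u \<in> I" for u
  proof -
    have "norm (\<Phi> (f u)) \<le> L * norm (f u - p)"
      using lipschitz_on_normD[OF L, of "f u" p] that by (simp add: eq)
    then have "\<bar>c u\<bar> * norm (\<Phi> (f u)) \<le> C * (L * norm (f u - p))"
      using C[OF that] by (intro mult_mono) auto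
    then have "norm (f u - p) * (\<bar>c u\<bar> * norm (\<Phi> (f u))) \<le> norm (f u - p) * (C * (L * norm (f u - p)))"
      by (rule mult_left_mono) simp
    moreover have "\<bar>(f u - p) \<bullet> c u *\<^sub>R \<Phi> (f u)\<bar> \<le> norm (f u - p) * (\<bar>c u\<bar> * norm (\<Phi> (f u)))"
      using Cauchy_Schwarz_ineq2[of "f u - p" "c u *\<^sub>R \<Phi> (f u)"] by simp
    moreover have "w u = norm (f u - p) * norm (f u - p)"
      by (simp add: w_def norm_eq_sqrt_inner)
    ultimately show ?thesis
      by (simp add: w'_def k_def mult_ac abs_mult)
  qed
  have "w t \<le> 0"
  proof (cases "t\<^sub>0 \<le> t")
    case True
    have "w t * exp (- k * t) \<le> w t\<^sub>0 * exp (- k * t\<^sub>0)"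
    proof (rule DERIV_nonpos_imp_nonincreasing[OF True])
      fix u assume "t\<^sub>0 \<le> u" "u \<le> t"
      then have u: "u \<in> I" by (auto simp: I_def closed_segment_eq_real_ivl)
      have "((\<lambda>u. w u * exp (- k * u)) has_real_derivative (w' u - k * w u) * exp (- k * u)) (at u)"
        by (auto intro!: derivative_eq_intros w[OF u] simp: algebra_simps)
      moreover have "(w' u - k * w u) * exp (- k * u) \<le> 0"
        using w'[OF u] by (intro mult_nonpos_nonneg) auto
      ultimately show "\<exists>y. ((\<lambda>u. w u * exp (- k * u)) has_real_derivative y) (at u) \<and> y \<le> 0"
        by blast
    qed
    then show ?thesis by (simp add: w_def eq mult_le_0_iff)
  next
    case False
    have "w t * exp (k * t) \<le> w t\<^sub>0 * exp (k * t\<^sub>0)"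
    proof (rule DERIV_nonneg_imp_nondecreasing[where f = "\<lambda>u. w u * exp (k * u)"])
      show "t \<le> t\<^sub>0" using False by simp
    next
      fix u assume "t \<le> u" "u \<le> t\<^sub>0"
      then have u: "u \<in> I" by (auto simp: I_def closed_segment_eq_real_ivl)
      have "((\<lambda>u. w u * exp (k * u)) has_real_derivative (w' u + k * w u) * exp (k * u)) (at u)"
        by (auto intro!: derivative_eq_intros w[OF u] simp: algebra_simps)
      moreover have "(w' u + k * w u) * exp (k * u) \<ge> 0"
        using w'[OF u] by (intro mult_nonneg_nonneg) auto
      ultimately show "\<exists>y. ((\<lambda>u. w u * exp (k * u)) has_real_derivative y) (at u) \<and> y \<ge> 0"
        by blast
    qed
    then show ?thesis by (simp add: w_def eq mult_le_0_iff)
  qed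
  then show ?thesis
    by (simp add: w_def flip: power2_norm_eq_inner)
qed

section \<open>The Ricci operator of an almost abelian Lie algebra\<close>

definition skew_part :: "real^'n^'n \<Rightarrow> real^'n^'n" where
  "skew_part A = (1/2) *\<^sub>R (A - transpose A)"

lemma inner_matrix_vector_mult: "(A *v x) \<bullet> y = x \<bullet> (transpose A *v y)"
  for A :: "real^'n^'n"
  by (metis dot_lmul_matrix inner_commute transpose_matrix_vector)

lemma transpose_sym_part [simp]: "transpose (sym_part A) = sym_part A"
  by (simp add: sym_part_def transpose_scalar transpose_plus add.commute)

lemma transpose_skew_part [simp]: "transpose (skew_part A) = - skew_part A"
  by (simp add: skew_part_def transpose_scalar transpose_diff scaleR_diff_right)

lemma sym_part_plus_skew_part: "sym_part A + skew_part A = A"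
  by (simp add: sym_part_def skew_part_def scaleR_diff_right scaleR_add_right
      flip: scaleR_left.add)

lemma inner_sym_part: "(sym_part A *v x) \<bullet> y = x \<bullet> (sym_part A *v y)"
  by (simp only: inner_matrix_vector_mult transpose_sym_part)

lemma minus_matrix_vector_mult: "(- A) *v x = - (A *v x)" for A :: "real^'n^'n"
  by (simp add: matrix_vector_mult_def vec_eq_iff sum_negf)

lemma inner_skew_part: "(skew_part A *v x) \<bullet> y = - (x \<bullet> (skew_part A *v y))"
  by (simp only: inner_matrix_vector_mult transpose_skew_part minus_matrix_vector_mult inner_minus_right)

text \<open>
  With \<open>S\<close> and \<open>K\<close> the symmetric and skew parts of \<open>A\<close>, the connection is determined by
  \<open>\<nabla>\<^bsub>e\<^sub>0\<^esub> e\<^sub>0 = 0\<close>, \<open>\<nabla>\<^bsub>e\<^sub>0\<^esub> x = K x\<close>, \<open>\<nabla>\<^bsub>x\<^esub> e\<^sub>0 = - S x\<close> and \<open>\<nabla>\<^bsub>x\<^esub> y = \<langle>S x, y\<rangle> e\<^sub>0\<close>. These formulas define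
  a torsion-free metric connection, which is unique.
\<close>

lemma levi_civita_mu:
  fixes A :: "real^'n^'n"
  shows "levi_civita (mu A) X Y = (snd X \<bullet> (sym_part A *v snd Y),
     fst X *\<^sub>R (skew_part A *v snd Y) - fst Y *\<^sub>R (sym_part A *v snd X))"
proof -
  define N where "N X Y = (snd X \<bullet> (sym_part A *v snd Y),
     fst X *\<^sub>R (skew_part A *v snd Y) - fst Y *\<^sub>R (sym_part A *v snd X))" for X Y :: "real \<times> (real^'n)"
  have A: "A *v x = sym_part A *v x + skew_part A *v x" for x
    by (metis sym_part_plus_skew_part matrix_vector_mult_add_rdistrib)
  have "is_levi_civita (mu A) N"
    unfolding is_levi_civita_def bilinear_def
  proof (intro conjI allI linearI)
    fix X Y Z :: "real \<times> (real^'n)" and r :: real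
    show "N X Y - N Y X = mu A X Y"
      using inner_sym_part[of A "snd X" "snd Y"]
      by (simp add: N_def mu_def A inner_commute algebra_simps)
    show "N X Y \<bullet> Z + Y \<bullet> N X Z = 0"
      using inner_sym_part[of A "snd X" "snd Y"] inner_sym_part[of A "snd X" "snd Z"]
        inner_skew_part[of A "snd Y" "snd Z"]
      by (simp add: N_def inner_prod_def inner_diff_left inner_diff_right inner_commute algebra_simps)
  qed (simp_all add: N_def matrix_vector_right_distrib matrix_vector_mult_scaleR inner_add_left
      inner_add_right algebra_simps)
  then have "levi_civita (mu A) = N"
    unfolding levi_civita_def
    using ex1_levi_civita[OF lie_bracket_mu] by (rule the1_equality[rotated])
  then show ?thesis
    by (simp add: N_def)
qed

lemma sum_Basis_real_prod:
  fixes f :: "real \<times> (real^'n) \<Rightarrow> 'a::comm_monoid_add"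
  shows "(\<Sum>b\<in>Basis. f b) = f (1, 0) + (\<Sum>b\<in>Basis. f (0, b))"
proof -
  have "inj_on (\<lambda>v. (0::real, v)) (Basis :: (real^'n) set)"
    by (auto intro!: inj_onI)
  then show ?thesis
    unfolding Basis_prod_def by (subst sum.union_disjoint) (auto simp: sum.reindex)
qed

lemma trace_eq_sum_Basis: "trace A = (\<Sum>b\<in>Basis. (A *v b) \<bullet> b)" for A :: "real^'n^'n"
proof -
  have inj: "inj (\<lambda>i::'n. axis i (1::real))"
    by (auto intro!: injI simp: axis_eq_axis)
  have B: "Basis = range (\<lambda>i::'n. axis i (1::real))"
    by (auto simp: Basis_vec_def)
  show ?thesis
    unfolding B sum.reindex[OF inj]
    by (simp add: trace_def inner_axis matrix_vector_mult_basis column_def)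
qed

lemma inner_eq_sum_Basis: "(\<Sum>b\<in>Basis. (b \<bullet> x) * (y \<bullet> b)) = x \<bullet> y" for x y :: "'a::euclidean_space"
  by (simp add: euclidean_inner[of x y] inner_commute)

text \<open>
  The contributions of \<open>e\<^sub>0\<close> and of an orthonormal basis of \<open>\<real>\<^sup>n\<close> to the trace are computed separately.
  The terms \<open>tr (K S)\<close> vanish because \<open>K\<close> is skew and \<open>S\<close> symmetric, and the remaining quadratic
  expressions in \<open>S\<close> and \<open>K\<close> combine to half the moment map, as \<open>[A, A\<^sup>t] = 2 [K, S]\<close>.
\<close>

lemma ricci_mu:
  "ricci (mu A) X Y = - trace (sym_part A ** sym_part A) * fst X * fst Y
     + ((1/2) *\<^sub>R (moment A *v snd X) - trace A *\<^sub>R (sym_part A *v snd X)) \<bullet> snd Y"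
proof -
  obtain a x where X: "X = (a, x)" by (cases X)
  obtain c y where Y: "Y = (c, y)" by (cases Y)
  let ?S = "sym_part A" and ?K = "skew_part A"
  have e0: "riemann (mu A) (1, 0) X Y \<bullet> (1, 0) = - (x \<bullet> (?S *v (?K *v y))) - (A *v x) \<bullet> (?S *v y)"
    by (simp add: riemann_def levi_civita_mu X Y mu_def inner_prod_def)
  have ei: "riemann (mu A) (0, b) X Y \<bullet> (0, b) =
      - (x \<bullet> (?S *v y)) * ((?S *v b) \<bullet> b) + a * c * (((?K ** ?S) *v b) \<bullet> b)
      + (b \<bullet> (?S *v y)) * ((?S *v x) \<bullet> b) - a * c * (((?S ** A) *v b) \<bullet> b)" for b
    by (simp add: riemann_def levi_civita_mu X Y mu_def inner_prod_def matrix_vector_mul_assoc[symmetric]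
        matrix_vector_mult_scaleR matrix_vector_mult_diff_distrib inner_diff_left algebra_simps
        vec.neg)
  have "ricci (mu A) X Y = - (x \<bullet> (?S *v (?K *v y))) - (A *v x) \<bullet> (?S *v y)
      - (x \<bullet> (?S *v y)) * trace ?S + a * c * trace (?K ** ?S)
      + (?S *v y) \<bullet> (?S *v x) - a * c * trace (?S ** A)"
    unfolding ricci_def sum_Basis_real_prod e0 ei
    by (simp add: sum.distrib sum_subtractf trace_eq_sum_Basis inner_eq_sum_Basis
        flip: sum_distrib_left) 
  moreover have KS: "trace (?K ** ?S) = 0"
  proof -
    have "trace (?K ** ?S) = ?K \<bullet> ?S"
      by (simp add: inner_matrix_eq_trace)
    moreover have "?K \<bullet> ?S = - (?K \<bullet> ?S)"
      by (metis inner_transpose transpose_sym_part transpose_skew_part inner_minus_left)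
    ultimately show ?thesis by simp
  qed
  moreover have "trace (?S ** A) = trace (?S ** ?S)"
  proof -
    have "trace (?S ** A) = trace (?S ** ?S) + trace (?S ** ?K)"
      by (metis sym_part_plus_skew_part matrix_add_ldistrib trace_add)
    then show ?thesis
      by (metis KS trace_mul_sym add_0_right)
  qed
  moreover have "trace ?S = trace A"
    by (simp add: sym_part_def trace_scaleR trace_add) (simp add: trace_def transpose_def)
  moreover have "- (x \<bullet> (?S *v (?K *v y))) - (A *v x) \<bullet> (?S *v y) + (?S *v y) \<bullet> (?S *v x)
      = (1/2) * ((moment A *v x) \<bullet> y)"
  proof -
    have Ax: "A *v z = ?S *v z + ?K *v z" for z
      by (metis sym_part_plus_skew_part matrix_vector_mult_add_rdistrib)
    have At: "transpose A = ?S - ?K"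
      by (metis (no_types, lifting) sym_part_plus_skew_part transpose_plus transpose_sym_part
          transpose_skew_part uminus_add_conv_diff add.commute)
    have "moment A *v x = A *v (transpose A *v x) - transpose A *v (A *v x)"
      unfolding moment_def commutator_def
      by (simp add: matrix_vector_mult_diff_rdistrib matrix_vector_mul_assoc del: transpose_matrix_vector)
    also have "\<dots> = 2 *\<^sub>R (?K *v (?S *v x) - ?S *v (?K *v x))"
      unfolding At
      by (simp add: Ax matrix_vector_mult_diff_rdistrib matrix_vector_mult_diff_distrib
          matrix_vector_right_distrib scaleR_2)
    finally have "(1/2) * ((moment A *v x) \<bullet> y) = (?K *v (?S *v x)) \<bullet> y - (?S *v (?K *v x)) \<bullet> y"
      by (simp add: inner_diff_left)
    also have "\<dots> = - (x \<bullet> (?S *v (?K *v y))) - (?K *v x) \<bullet> (?S *v y)"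
      by (simp add: inner_sym_part inner_skew_part)
    finally show ?thesis
      by (simp add: Ax inner_add_left inner_commute[of "?S *v y" "?S *v x"])
  qed
  ultimately show ?thesis
    by (simp add: X Y inner_diff_left inner_sym_part algebra_simps)
qed

lemma ricci_operator_mu:
  "ricci_operator (mu A) X = (- trace (sym_part A ** sym_part A) * fst X,
     ((1/2) *\<^sub>R moment A - trace A *\<^sub>R sym_part A) *v snd X)"
proof -
  have "ricci (mu A) X Y = (- trace (sym_part A ** sym_part A) * fst X,
     ((1/2) *\<^sub>R moment A - trace A *\<^sub>R sym_part A) *v snd X) \<bullet> Y" for Y
    by (simp add: ricci_mu inner_prod_def matrix_vector_mult_diff_rdistrib scaleR_matrix_vector_assoc)
  then show ?thesis
    unfolding ricci_operator_def by (simp add: euclidean_representation)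
qed

lemma derivation_mu_diagonal_iff:
  "derivation (mu A) (\<lambda>X. (d * fst X, E *v snd X)) \<longleftrightarrow> commutator E A = d *\<^sub>R A"
proof
  assume D: "derivation (mu A) (\<lambda>X. (d * fst X, E *v snd X))"
  have "commutator E A *v x = (d *\<^sub>R A) *v x" for x
  proof -
    have "E *v (A *v x) = d *\<^sub>R (A *v x) + A *v (E *v x)"
      using D[unfolded derivation_def, THEN conjunct2, rule_format, of "(1, 0)" "(0, x)"]
      by (simp add: mu_def)
    then show ?thesis
      by (simp add: commutator_def matrix_vector_mult_diff_rdistrib matrix_vector_mul_assoc[symmetric]
          scaleR_matrix_vector_assoc[symmetric])
  qed
  then show "commutator E A = d *\<^sub>R A"
    by (simp add: matrix_eq)
next
  assume C: "commutator E A = d *\<^sub>R A"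
  have EA: "E *v (A *v x) = d *\<^sub>R (A *v x) + A *v (E *v x)" for x
  proof -
    have "commutator E A *v x = d *\<^sub>R (A *v x)"
      by (simp add: C scaleR_matrix_vector_assoc)
    then show ?thesis
      by (simp add: commutator_def matrix_vector_mult_diff_rdistrib matrix_vector_mul_assoc[symmetric]
          algebra_simps)
  qed
  show "derivation (mu A) (\<lambda>X. (d * fst X, E *v snd X))"
    unfolding derivation_def
    by (auto intro!: linearI simp: mu_def matrix_vector_right_distrib matrix_vector_mult_scaleR
        matrix_vector_mult_diff_distrib EA algebra_simps)
qed

text \<open>
  For a given \<open>c\<close> the only candidate for \<open>D\<close> is \<open>Ric - c I\<close>. It is block diagonal, and the commutator of
  its block on \<open>\<real>\<^sup>n\<close> with \<open>A\<close> is \<open>- drift A\<close> for every \<open>c\<close>, whereas the eigenvalue at \<open>e\<^sub>0\<close>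
  takes every real value as \<open>c\<close> varies.
\<close>

lemma algebraic_soliton_mu_iff:
  "algebraic_soliton (mu A) \<longleftrightarrow> (\<exists>k. drift A = k *\<^sub>R A)"
proof -
  define T where "T = trace (sym_part A ** sym_part A)"
  define R where "R = (1/2) *\<^sub>R moment A - trace A *\<^sub>R sym_part A"
  have comm: "commutator (R - c *\<^sub>R mat 1) A = - drift A" for c
  proof -
    interpret bounded_bilinear "commutator :: real^'n^'n \<Rightarrow> real^'n^'n \<Rightarrow> real^'n^'n"
      by (rule bounded_bilinear_commutator)
    have "commutator (mat 1) A = 0"
      by (simp add: commutator_def)
    moreover have "commutator (sym_part A) A = - ((1/2) *\<^sub>R moment A)"
      by (simp add: sym_part_def scaleR_left add_left moment_def commutator_swap[of "transpose A"])
    ultimately show ?thesis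
      by (simp add: R_def drift_def diff_left scaleR_left commutator_swap[of A "moment A"])
  qed
  have D: "(\<forall>X. ricci_operator (mu A) X = c *\<^sub>R X + D X) \<longleftrightarrow>
      D = (\<lambda>X. ((- T - c) * fst X, (R - c *\<^sub>R mat 1) *v snd X))" for c D
    unfolding ricci_operator_mu T_def[symmetric] R_def[symmetric] fun_eq_iff
    by (auto simp: prod_eq_iff algebra_simps matrix_vector_mult_diff_rdistrib
        scaleR_matrix_vector_assoc[symmetric])
  have "algebraic_soliton (mu A) \<longleftrightarrow> (\<exists>c. - drift A = (- T - c) *\<^sub>R A)"
    unfolding algebraic_soliton_def D by (auto simp: derivation_mu_diagonal_iff comm)
  also have "\<dots> \<longleftrightarrow> (\<exists>k. drift A = k *\<^sub>R A)"
  proof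
    assume "\<exists>c. - drift A = (- T - c) *\<^sub>R A"
    then obtain c where "- drift A = (- T - c) *\<^sub>R A" ..
    then have "drift A = (T + c) *\<^sub>R A"
      by (metis minus_diff_eq minus_minus diff_minus_eq_add scaleR_minus_left add.commute)
    then show "\<exists>k. drift A = k *\<^sub>R A" ..
  next
    assume "\<exists>k. drift A = k *\<^sub>R A"
    then obtain k where "drift A = k *\<^sub>R A" ..
    then have "- drift A = (- T - (k - T)) *\<^sub>R A" by simp
    then show "\<exists>c. - drift A = (- T - c) *\<^sub>R A" ..
  qed
  finally show ?thesis .
qed

section \<open>Monotonicity and rigidity\<close>

theorem lemma3p6:
  fixes A\<^sub>0 :: "real^'n^'n" and A B :: "real \<Rightarrow> real^'n^'n" and J :: "real set"
  assumes "A\<^sub>0 \<noteq> 0"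
    and "bracket_flow A\<^sub>0 J A"
    and "B = (\<lambda>t. (1 / norm (A t)) *\<^sub>R A t)"
  shows "(\<forall>t\<in>J. 0 \<le> F (B t)) \<and>
    antimono_on J (\<lambda>t. F (B t)) \<and>
    ((\<exists>t\<^sub>0\<in>J. ((\<lambda>t. F (B t)) has_real_derivative 0) (at t\<^sub>0)) \<longleftrightarrow> algebraic_soliton (mu (B 0)))"
proof -
  have J: "is_interval J" "0 \<in> J" and A0: "A 0 = A\<^sub>0"
    and A: "\<And>t. t \<in> J \<Longrightarrow> (A has_vector_derivative bracket_flow_rhs (A t)) (at t)"
    using assms(2) by (auto simp: bracket_flow_def flow_solution_def)
  have nz: "A t \<noteq> 0" if t: "t \<in> J" for t
  proof
    assume "A t = 0"
    moreover have "bracket_flow_rhs (0 :: real^'n^'n) = 0"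
      by (simp add: bracket_flow_rhs_def commutator_def)
    ultimately have "A 0 = 0"
      using ode_stays_at_equilibrium[of J t 0 A "\<lambda>_. 1" bracket_flow_rhs 0] J t A
      by (simp add: bracket_flow_rhs_lipschitz_on)
    then show False using assms(1) A0 by simp
  qed
  have nB: "norm (B t) = 1" if "t \<in> J" for t
    using nz[OF that] by (simp add: assms(3))
  have B: "(B has_vector_derivative (norm (A t))\<^sup>2 *\<^sub>R sphere_drift (B t)) (at t)" if "t \<in> J" for t
    using normalized_flow_derivative[OF A nz, OF that that] by (simp add: assms(3))
  define f where "f t = - 2 * (norm (A t))\<^sup>2 *
      ((norm (commutator (B t) (moment (B t))))\<^sup>2 - F (B t) ^ 2)" for t
  have F: "((\<lambda>t. F (B t)) has_real_derivative f t) (at t)" if t: "t \<in> J" for t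
    unfolding has_field_derivative_def
    by (rule has_derivative_eq_rhs[OF has_derivative_compose[OF
            B[OF t, unfolded has_vector_derivative_def] has_derivative_F]])
      (simp add: fun_eq_iff inner_sphere_drift_commutator_moment[OF nB[OF t]] f_def)
  have f_le: "f t \<le> 0" if "t \<in> J" for t
    using F_le_norm_commutator_moment[OF nB[OF that]]
    by (simp add: f_def mult_nonneg_nonneg)
  have "antimono_on J (\<lambda>t. F (B t))"
  proof (rule monotone_onI)
    fix s t assume st: "s \<in> J" "t \<in> J" "s \<le> t"
    show "F (B t) \<le> F (B s)"
    proof (rule DERIV_nonpos_imp_nonincreasing[OF st(3), of "\<lambda>t. F (B t)"])
      fix u assume "s \<le> u" "u \<le> t"
      then have "u \<in> J"
        using J(1) st by (meson mem_is_interval_1_I)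
      then show "\<exists>y. ((\<lambda>t. F (B t)) has_real_derivative y) (at u) \<and> y \<le> 0"
        using F f_le by blast
    qed
  qed
  moreover have "((\<lambda>t. F (B t)) has_real_derivative 0) (at t) \<longleftrightarrow> sphere_drift (B t) = 0"
    if t: "t \<in> J" for t
  proof -
    have "((\<lambda>t. F (B t)) has_real_derivative 0) (at t) \<longleftrightarrow> f t = 0"
      using F[OF t] DERIV_unique by fastforce
    then show ?thesis
      using nz[OF t] norm_commutator_moment_eq_iff[OF nB[OF t]] by (auto simp: f_def)
  qed
  moreover have "sphere_drift (B 0) = 0" if t: "t \<in> J" and eq: "sphere_drift (B t) = 0" for t
  proof -
    have "continuous_on J A"
      by (rule continuous_at_imp_continuous_on) (use A has_vector_derivative_continuous in blast)
    then have "continuous_on J (\<lambda>t. (norm (A t))\<^sup>2)"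
      by (intro continuous_intros)
    then have "B 0 = B t"
      using ode_stays_at_equilibrium[OF J(1) t J(2) B _ sphere_drift_lipschitz_on eq refl] by blast
    then show ?thesis using eq by simp
  qed
  moreover have "algebraic_soliton (mu (B 0)) \<longleftrightarrow> sphere_drift (B 0) = 0"
    by (simp add: algebraic_soliton_mu_iff sphere_drift_eq_0_iff nB J(2))
  ultimately show ?thesis
    using F_nonneg J(2) by blast
qed

end
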